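(* Let $D$ be a division algebra and let $\sigma$ be an automorphism of $D$ such that the field $F=\mathcal{Z}(D)\cap D_\sigma$ is infinite. Then for every $n\ge 0$, the constant tuple $(\sigma,\ldots,\sigma)$ of length $n$ is automorphically normalizable over $D$; that is, every quotient ring of $D[t_1,\ldots,t_n;\sigma,\ldots,\sigma]$ by a proper two-sided ideal is automorphically normalizable over $D$.
   Context: All rings are associative with unity. $\mathcal{Z}(D)$ is the center of $D$ and $D_\sigma=\{r\in D:\sigma(r)=r\}$. For commuting automorphisms $\sigma_1,\ldots,\sigma_n$ of $D$, the skew polynomial ring $D[t_1,\ldots,t_n;\sigma_1,\ldots,\sigma_n]$ consists of polynomials $\sum r_{\mathbf i}t_1^{i_1}\cdots t_n^{i_n}$ ($r_{\mathbf i}\in D$) in pairwise commuting variables, with multiplication determined by $t_ia=\sigma_i(a)t_i$ for $a\in D$. For a ring $S\supseteq D$, an element $a\in S$ is automorphic over $D$ with respect to $\tau\in\mathrm{Aut}(D)$ if $ab=\tau(b)a$ for all $b\in D$. $S$ is finite over a subring $R$ if it is finitely generated as a left $R$-module. Commuting elements $a_1,\ldots,a_m\in S$ are (left) algebraically independent over $D$ if the monomials $a_1^{i_1}\cdots a_m^{i_m}$ are left linearly independent over $D$. $S$ is automorphically normalizable over $D$ if there exist $m\ge0$ and commuting elements $a_1,\ldots,a_m\in S$, automorphic over $D$ with respect to pairwise commuting automorphisms $\tau_1,\ldots,\tau_m$ of $D$, left algebraically independent over $D$, such that $S$ is finite over the subring $D[a_1,\ldots,a_m]$ generated by $D\cup\{a_1,\ldots,a_m\}$.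 A tuple $(\sigma_1,\ldots,\sigma_n)$ of commuting automorphisms is automorphically normalizable over $D$ if every quotient of $D[t_1,\ldots,t_n;\sigma_1,\ldots,\sigma_n]$ by a proper two-sided ideal is automorphically normalizable over $D$. *)

theory Defs
  imports "HOL-Algebra.Algebra"
begin

definition is_automorphism :: "('a::ring_1 \<Rightarrow> 'a) \<Rightarrow> bool" where
  "is_automorphism \<sigma> \<longleftrightarrow> bij \<sigma> \<and> (\<forall>x y. \<sigma> (x + y) = \<sigma> x + \<sigma> y)
      \<and> (\<forall>x y. \<sigma> (x * y) = \<sigma> x * \<sigma> y) \<and> \<sigma> 1 = 1"

definition center_of :: "'a::ring_1 set" where
  "center_of = {z. \<forall>x. z * x = x * z}"

definition fixed_of :: "('a::ring_1 \<Rightarrow> 'a) \<Rightarrow> 'a set" where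
  "fixed_of \<sigma> = {r. \<sigma> r = r}"

text \<open>Exponent vectors are functions nat => nat vanishing from index n on.
  A polynomial is a finitely supported map from exponent vectors to D.\<close>

definition skew_carrier :: "nat \<Rightarrow> ((nat \<Rightarrow> nat) \<Rightarrow> 'a::ring_1) set" where
  "skew_carrier n = {p. finite {i. p i \<noteq> 0} \<and> (\<forall>i. p i \<noteq> 0 \<longrightarrow> (\<forall>k\<ge>n. i k = 0))}"

fun skew_pow :: "(nat \<Rightarrow> 'a \<Rightarrow> 'a) \<Rightarrow> (nat \<Rightarrow> nat) \<Rightarrow> nat \<Rightarrow> 'a \<Rightarrow> 'a" where
  "skew_pow \<sigma>s i 0 = id"
| "skew_pow \<sigma>s i (Suc k) = skew_pow \<sigma>s i k \<circ> (\<sigma>s k ^^ i k)"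

text \<open>(a t^i)(b t^j) = a sigma^i(b) t^(i+j)\<close>
definition skew_mult :: "(nat \<Rightarrow> 'a::ring_1 \<Rightarrow> 'a) \<Rightarrow> nat
    \<Rightarrow> ((nat \<Rightarrow> nat) \<Rightarrow> 'a) \<Rightarrow> ((nat \<Rightarrow> nat) \<Rightarrow> 'a) \<Rightarrow> ((nat \<Rightarrow> nat) \<Rightarrow> 'a)" where
  "skew_mult \<sigma>s n p q = (\<lambda>m. \<Sum>(i, j) \<in> {(i, j). p i \<noteq> 0 \<and> q j \<noteq> 0 \<and> (\<lambda>k. i k + j k) = m}.
       p i * skew_pow \<sigma>s i n (q j))"

definition skew_const :: "'a::ring_1 \<Rightarrow> ((nat \<Rightarrow> nat) \<Rightarrow> 'a)" where
  "skew_const c = (\<lambda>i. if i = (\<lambda>_. 0) then c else 0)"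

definition skew_poly_ring :: "(nat \<Rightarrow> 'a::ring_1 \<Rightarrow> 'a) \<Rightarrow> nat \<Rightarrow> ((nat \<Rightarrow> nat) \<Rightarrow> 'a) ring" where
  "skew_poly_ring \<sigma>s n =
     \<lparr> carrier = skew_carrier n, monoid.mult = skew_mult \<sigma>s n, one = skew_const 1,
       ring.zero = (\<lambda>_. 0), add = (\<lambda>p q i. p i + q i) \<rparr>"

fun ring_monom :: "('b, 'c) ring_scheme \<Rightarrow> (nat \<Rightarrow> 'b) \<Rightarrow> (nat \<Rightarrow> nat) \<Rightarrow> nat \<Rightarrow> 'b" where
  "ring_monom S a e 0 = \<one>\<^bsub>S\<^esub>"
| "ring_monom S a e (Suc k) = ring_monom S a e k \<otimes>\<^bsub>S\<^esub> (a k [^]\<^bsub>S\<^esub> e k)"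

text \<open>S is a ring containing D via the injective embedding iota.\<close>
definition automorphically_normalizable ::
    "('b, 'c) ring_scheme \<Rightarrow> ('a::ring_1 \<Rightarrow> 'b) \<Rightarrow> bool" where
  "automorphically_normalizable S \<iota> \<longleftrightarrow>
    (\<exists>(m::nat) (a :: nat \<Rightarrow> 'b) (\<tau> :: nat \<Rightarrow> 'a \<Rightarrow> 'a).
       (\<forall>i<m. a i \<in> carrier S)
     \<and> (\<forall>i<m. \<forall>j<m. a i \<otimes>\<^bsub>S\<^esub> a j = a j \<otimes>\<^bsub>S\<^esub> a i)
     \<and> (\<forall>i<m. is_automorphism (\<tau> i))
     \<and> (\<forall>i<m. \<forall>j<m. \<tau> i \<circ> \<tau> j = \<tau> j \<circ> \<tau> i)
     \<and> (\<forall>i<m. \<forall>b. a i \<otimes>\<^bsub>S\<^esub> \<iota> b = \<iota> (\<tau> i b) \<otimes>\<^bsub>S\<^esub> a i)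
     \<comment> \<open>left algebraic independence over D\<close>
     \<and> (\<forall>(c :: (nat \<Rightarrow> nat) \<Rightarrow> 'a) (E :: (nat \<Rightarrow> nat) set).
           finite E \<longrightarrow> (\<forall>e\<in>E. \<forall>k\<ge>m. e k = 0) \<longrightarrow>
           (\<Oplus>\<^bsub>S\<^esub> e\<in>E. \<iota> (c e) \<otimes>\<^bsub>S\<^esub> ring_monom S a e m) = \<zero>\<^bsub>S\<^esub> \<longrightarrow>
           (\<forall>e\<in>E. c e = 0))
     \<comment> \<open>S is finitely generated as a left module over the subring D[a_0,...,a_(m-1)]\<close>
     \<and> (\<exists>(k::nat) (g :: nat \<Rightarrow> 'b). (\<forall>l<k. g l \<in> carrier S) \<and>
           (\<forall>s\<in>carrier S. \<exists>r :: nat \<Rightarrow> 'b.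
              (\<forall>l<k. r l \<in> generate_ring S (range \<iota> \<union> a ` {..<m})) \<and>
              s = (\<Oplus>\<^bsub>S\<^esub> l\<in>{..<k}. r l \<otimes>\<^bsub>S\<^esub> g l))))"

definition tuple_automorphically_normalizable :: "(nat \<Rightarrow> 'a::ring_1 \<Rightarrow> 'a) \<Rightarrow> nat \<Rightarrow> bool" where
  "tuple_automorphically_normalizable \<sigma>s n \<longleftrightarrow>
    (\<forall>I. ideal I (skew_poly_ring \<sigma>s n) \<and> I \<noteq> carrier (skew_poly_ring \<sigma>s n) \<longrightarrow>
       automorphically_normalizable (skew_poly_ring \<sigma>s n Quot I)
         (\<lambda>c. I +>\<^bsub>skew_poly_ring \<sigma>s n\<^esub> skew_const c))"

end

theory Submission
  imports Defs
begin

text \<open>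
  Noether normalization over an infinite field, carried out inside an arbitrary ring \<open>S\<close>
  that receives \<open>D\<close> and is generated by commuting \<open>\<sigma>\<close>-automorphic elements
  \<open>a\<^sub>0, \<dots>, a\<^sub>n\<close>. If these are left dependent, choose scalars \<open>l\<^sub>i\<close> in the infinite field
  \<open>F\<close> and replace \<open>a\<^sub>i\<close> by \<open>b\<^sub>i = a\<^sub>i - l\<^sub>i a\<^sub>n\<close>. As the \<open>l\<^sub>i\<close> are central and fixed by \<open>\<sigma>\<close>, the
  \<open>b\<^sub>i\<close> are again commuting and \<open>\<sigma>\<close>-automorphic. The coefficient of the top power of \<open>a\<^sub>n\<close> in
  the substituted relation is the leading form evaluated at \<open>(l\<^sub>0, \<dots>, l\<^sub>n\<^sub>-\<^sub>1, 1)\<close>; some choice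
  makes it nonzero, because a nonzero one-variable polynomial with left coefficients in \<open>D\<close> has
  finitely many central roots. Then \<open>a\<^sub>n\<close> is integral over the subring generated by \<open>D\<close> and
  the \<open>b\<^sub>i\<close>, and one inducts on the number of generators.
\<close>

section \<open>Central zeros of polynomials over a division ring\<close>

text \<open>Peeling off the top term turns the sum for \<open>n\<close> into \<open>w\<close> times
  itself plus \<open>z ^ Suc n\<close>. Only commutation of \<open>z\<close> with \<open>w\<close>
  enters, and the factor \<open>z - w\<close> stays on the right.\<close>

lemma central_power_diff:
  fixes z w :: "'a::ring_1"
  assumes "z * w = w * z"
  shows "z ^ Suc n - w ^ Suc n = (\<Sum>i\<le>n. w ^ (n - i) * z ^ i) * (z - w)"
proof (induction n)
  case (Suc n)
  have "(\<Sum>i\<le>Suc n. w ^ (Suc n - i) * z ^ i) = w * (\<Sum>i\<le>n. w ^ (n - i) * z ^ i) + z ^ Suc n"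
    by (simp add: sum_distrib_left Suc_diff_le mult.assoc)
  then have "(\<Sum>i\<le>Suc n. w ^ (Suc n - i) * z ^ i) * (z - w)
      = w * ((\<Sum>i\<le>n. w ^ (n - i) * z ^ i) * (z - w)) + z ^ Suc n * (z - w)"
    by (simp add: distrib_right mult.assoc)
  also have "\<dots> = w * (z ^ Suc n - w ^ Suc n) + z ^ Suc n * (z - w)"
    using Suc.IH by simp
  also have "\<dots> = z ^ Suc (Suc n) - w ^ Suc (Suc n)"
    using assms power_commuting_commutes[of z w "Suc n"]
    by (simp add: algebra_simps power_Suc2[of z "Suc n"] del: power_Suc)
      (metis power_Suc power_Suc2)
  finally show ?case by simp
qed simp

text \<open>Centrality makes \<open>w\<close> commute with every \<open>z\<close>, so a single
  quotient \<open>q\<close> serves all \<open>z\<close>. Keeping the top coefficient is what permits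
  an induction on the degree when zeros are counted.\<close>

lemma central_polyfun_factor:
  fixes \<gamma> :: "nat \<Rightarrow> 'a::ring_1"
  assumes w: "w \<in> center_of"
  shows "\<exists>q. q n = \<gamma> (Suc n) \<and> (\<forall>z. (\<Sum>j\<le>Suc n. \<gamma> j * z ^ j) - (\<Sum>j\<le>Suc n. \<gamma> j * w ^ j)
            = (\<Sum>i\<le>n. q i * z ^ i) * (z - w))"
proof (induction n)
  case 0
  show ?case by (rule exI[of _ "\<lambda>_. \<gamma> 1"]) (simp add: algebra_simps)
next
  case (Suc n)
  then obtain q where q: "\<And>z. (\<Sum>j\<le>Suc n. \<gamma> j * z ^ j) - (\<Sum>j\<le>Suc n. \<gamma> j * w ^ j)
            = (\<Sum>i\<le>n. q i * z ^ i) * (z - w)" by blast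
  define q' where "q' i = (if i \<le> n then q i else 0) + \<gamma> (Suc (Suc n)) * w ^ (Suc n - i)" for i
  show ?case
  proof (intro exI[of _ q'] conjI allI)
    show "q' (Suc n) = \<gamma> (Suc (Suc n))" by (simp add: q'_def)
    fix z
    have zw: "z * w = w * z" using w by (simp add: center_of_def)
    have "(\<Sum>i\<le>Suc n. q' i * z ^ i)
        = (\<Sum>i\<le>n. q i * z ^ i) + \<gamma> (Suc (Suc n)) * (\<Sum>i\<le>Suc n. w ^ (Suc n - i) * z ^ i)"
      unfolding q'_def
      by (simp add: distrib_right sum.distrib sum_distrib_left mult.assoc distrib_left)
    then have "(\<Sum>i\<le>Suc n. q' i * z ^ i) * (z - w)
        = (\<Sum>i\<le>n. q i * z ^ i) * (z - w)
          + \<gamma> (Suc (Suc n)) * (z ^ Suc (Suc n) - w ^ Suc (Suc n))"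
      by (simp only: central_power_diff[OF zw] distrib_right mult.assoc)
    also have "\<dots> = (\<Sum>j\<le>Suc (Suc n). \<gamma> j * z ^ j) - (\<Sum>j\<le>Suc (Suc n). \<gamma> j * w ^ j)"
      unfolding q[symmetric] by (simp add: algebra_simps)
    finally show "(\<Sum>j\<le>Suc (Suc n). \<gamma> j * z ^ j) - (\<Sum>j\<le>Suc (Suc n). \<gamma> j * w ^ j)
        = (\<Sum>i\<le>Suc n. q' i * z ^ i) * (z - w)" by simp
  qed
qed

text \<open>Dividing by \<open>z - w\<close> for one zero \<open>w\<close> leaves a polynomial of
  lower degree that vanishes on the still infinite set \<open>Z - {w}\<close>, since a division ring
  has no zero divisors. Its top coefficient is that of \<gamma>; once this is zero, the induction
  hypothesis covers the truncated \<gamma>.\<close>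

lemma central_polyfun_zero:
  fixes \<gamma> :: "nat \<Rightarrow> 'a::division_ring"
  assumes "infinite Z" "Z \<subseteq> center_of" "\<And>z. z \<in> Z \<Longrightarrow> (\<Sum>j\<le>n. \<gamma> j * z ^ j) = 0" "j \<le> n"
  shows "\<gamma> j = 0"
  using assms
proof (induction n arbitrary: \<gamma> Z j)
  case 0
  then obtain z where "z \<in> Z" using infinite_imp_nonempty by blast
  with 0 show ?case by auto
next
  case (Suc n)
  then obtain w where w: "w \<in> Z" using infinite_imp_nonempty by blast
  obtain q where qn: "q n = \<gamma> (Suc n)"
    and q: "\<And>z. (\<Sum>j\<le>Suc n. \<gamma> j * z ^ j) - (\<Sum>j\<le>Suc n. \<gamma> j * w ^ j)
            = (\<Sum>i\<le>n. q i * z ^ i) * (z - w)"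
    using central_polyfun_factor[of w n \<gamma>] w Suc.prems(2) by blast
  have "(\<Sum>i\<le>n. q i * z ^ i) = 0" if "z \<in> Z - {w}" for z
    using q[of z] Suc.prems(3)[of z] Suc.prems(3)[OF w] that by auto
  then have "q n = 0"
    using Suc.IH[of "Z - {w}" q n] Suc.prems(1,2) by auto
  then have top: "\<gamma> (Suc n) = 0" using qn by simp
  then have "(\<Sum>i\<le>n. \<gamma> i * z ^ i) = 0" if "z \<in> Z" for z
    using Suc.prems(3)[OF that] by simp
  then have "\<gamma> i = 0" if "i \<le> n" for i
    using Suc.IH[of Z \<gamma> i] Suc.prems(1,2) that by auto
  then show ?case using top Suc.prems(4) by (cases "j = Suc n") auto
qed

text \<open>The recursion runs parallel to \<open>ring_monom\<close>, so that
  \<open>lead_monom\<close> can compare the two factor by factor.\<close>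

fun eval_monom :: "(nat \<Rightarrow> 'a::monoid_mult) \<Rightarrow> (nat \<Rightarrow> nat) \<Rightarrow> nat \<Rightarrow> 'a" where
  "eval_monom l e 0 = 1"
| "eval_monom l e (Suc k) = eval_monom l e k * l k ^ e k"

lemma eval_monom_cong: "(\<And>k. k < n \<Longrightarrow> l k = l' k) \<Longrightarrow> eval_monom l e n = eval_monom l' e n"
  by (induction n) auto

lemma central_nonvanishing_point:
  fixes c :: "(nat \<Rightarrow> nat) \<Rightarrow> 'a::division_ring"
  assumes "infinite Z" "Z \<subseteq> center_of" "finite E"
    \<comment> \<open>injectivity instead of a support condition, so that it also applies to a homogeneous form
      in one more variable, where the last exponent is determined by the others\<close>
    and "\<And>e e'. e \<in> E \<Longrightarrow> e' \<in> E \<Longrightarrow> (\<And>k. k < n \<Longrightarrow> e k = e' k) \<Longrightarrow> e = e'"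
    and "e0 \<in> E" "c e0 \<noteq> 0"
  shows "\<exists>l. (\<forall>k. l k \<in> Z) \<and> (\<Sum>e\<in>E. c e * eval_monom l e n) \<noteq> 0"
  using assms(3-)
proof (induction n arbitrary: E)
  case 0
  obtain z where z: "z \<in> Z" using infinite_imp_nonempty[OF assms(1)] by blast
  have "E = {e0}" using 0 by blast
  then show ?case using z 0 by (intro exI[of _ "\<lambda>_. z"]) auto
next
  case (Suc n)
  \<comment> \<open>Slice by the last exponent. Within a slice, injectivity holds in one variable
    fewer, and the slice of \<open>e0\<close> still carries a nonzero coefficient.\<close>
  define E' where "E' j = {e \<in> E. e n = j}" for j
  have fin: "finite (E' j)" for j unfolding E'_def using Suc.prems(1) by simp
  have inj: "e = e'" if "e \<in> E' (e0 n)" "e' \<in> E' (e0 n)" "\<And>k. k < n \<Longrightarrow> e k = e' k" for e e'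
    by (rule Suc.prems(2)) (use that in \<open>auto simp: E'_def less_Suc_eq\<close>)
  have "e0 \<in> E' (e0 n)" using Suc.prems(3) by (simp add: E'_def)
  from Suc.IH[OF fin inj this Suc.prems(4)]
  obtain l where l: "\<And>k. l k \<in> Z" and nz: "(\<Sum>e\<in>E' (e0 n). c e * eval_monom l e n) \<noteq> 0"
    by blast
  define N where "N = Max ((\<lambda>e. e n) ` E)"
  have N: "e n \<le> N" if "e \<in> E" for e unfolding N_def using that Suc.prems(1) by simp
  \<comment> \<open>With the first \<open>n\<close> coordinates fixed, the sum is a polynomial in
    the last coordinate with coefficients \<open>\<gamma> j\<close>; the choice of \<open>l\<close>
    makes \<open>\<gamma> (e0 n)\<close> nonzero.\<close>
  define \<gamma> where "\<gamma> j = (\<Sum>e\<in>E' j. c e * eval_monom l e n)" for j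
  have "\<exists>z\<in>Z. (\<Sum>j\<le>N. \<gamma> j * z ^ j) \<noteq> 0"
    using central_polyfun_zero[OF assms(1,2), of \<gamma> N "e0 n"] nz N[OF Suc.prems(3)]
    unfolding \<gamma>_def by blast
  then obtain z where z: "z \<in> Z" "(\<Sum>j\<le>N. \<gamma> j * z ^ j) \<noteq> 0" by blast
  have eq: "eval_monom (l(n := z)) e n = eval_monom l e n" for e
    by (rule eval_monom_cong) simp
  have "(\<Sum>e\<in>E. c e * eval_monom (l(n := z)) e (Suc n))
      = (\<Sum>j\<le>N. \<Sum>e\<in>E' j. c e * eval_monom (l(n := z)) e (Suc n))"
    unfolding E'_def using Suc.prems(1) N by (subst sum.group) auto
  also have "\<dots> = (\<Sum>j\<le>N. \<gamma> j * z ^ j)"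
    unfolding \<gamma>_def sum_distrib_right
    by (intro sum.cong refl) (auto simp: eq E'_def mult.assoc)
  finally have "(\<Sum>e\<in>E. c e * eval_monom (l(n := z)) e (Suc n)) \<noteq> 0" using z(2) by simp
  moreover have "\<forall>k. (l(n := z)) k \<in> Z" using z(1) l by simp
  ultimately show ?case by blast
qed

section \<open>Left spans over a subring\<close>

text \<open>Adding one term at a time, with repeated generators allowed, gives closure properties by
  induction; \<open>lspan_finsum\<close> recovers an ordinary finite sum.\<close>

inductive_set (in ring) lspan :: "'a set \<Rightarrow> 'a set \<Rightarrow> 'a set" for B G where
  lspan_zero: "\<zero> \<in> lspan B G"
| lspan_step: "r \<in> B \<Longrightarrow> g \<in> G \<Longrightarrow> m \<in> lspan B G \<Longrightarrow> r \<otimes> g \<oplus> m \<in> lspan B G"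

context ring
begin

lemma lspan_closed:
  "B \<subseteq> carrier R \<Longrightarrow> G \<subseteq> carrier R \<Longrightarrow> x \<in> lspan B G \<Longrightarrow> x \<in> carrier R"
  by (rotate_tac 2, induction rule: lspan.induct) auto

lemma lspan_mono: "G \<subseteq> H \<Longrightarrow> x \<in> lspan B G \<Longrightarrow> x \<in> lspan B H"
  by (rotate_tac, induction rule: lspan.induct) (auto intro: lspan.intros)

lemma lspan_add:
  assumes "B \<subseteq> carrier R" "G \<subseteq> carrier R" "x \<in> lspan B G" "y \<in> lspan B G"
  shows "x \<oplus> y \<in> lspan B G"
  using assms(3)
proof (induction rule: lspan.induct)
  case lspan_zero
  then show ?case using assms lspan_closed by simp
next
  case (lspan_step r g m)
  then have "r \<otimes> g \<oplus> m \<oplus> y = r \<otimes> g \<oplus> (m \<oplus> y)"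
    using assms lspan_closed by (intro a_assoc) auto
  then show ?case using lspan_step by (simp add: lspan.lspan_step)
qed

lemma lspan_lmult:
  assumes "subring B R" "G \<subseteq> carrier R" "b \<in> B" "x \<in> lspan B G"
  shows "b \<otimes> x \<in> lspan B G"
  using assms(4)
proof (induction rule: lspan.induct)
  case lspan_zero
  have "b \<in> carrier R" using assms(3) subringE(1)[OF assms(1)] by blast
  then show ?case by (simp add: lspan.lspan_zero)
next
  case (lspan_step r g m)
  have B: "B \<subseteq> carrier R" using subringE(1)[OF assms(1)] .
  have "b \<otimes> (r \<otimes> g \<oplus> m) = (b \<otimes> r) \<otimes> g \<oplus> b \<otimes> m"
    using lspan_step assms(2,3) B lspan_closed[OF B assms(2)]
    by (subst r_distr) (auto simp: m_assoc subset_iff)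
  then show ?case
    using lspan_step assms(3) subringE(6)[OF assms(1)] by (simp add: lspan.lspan_step)
qed

lemma lspan_minus:
  assumes "subring B R" "G \<subseteq> carrier R" "x \<in> lspan B G"
  shows "\<ominus> x \<in> lspan B G"
proof -
  have "x \<in> carrier R" using assms subringE(1) lspan_closed by blast
  then have "\<ominus> x = \<ominus> \<one> \<otimes> x" by (simp add: l_minus)
  then show ?thesis
    using lspan_lmult[OF assms(1,2) _ assms(3), of "\<ominus> \<one>"] subringE(3,5)[OF assms(1)] by simp
qed

lemma lspan_single:
  assumes "B \<subseteq> carrier R" "G \<subseteq> carrier R" "r \<in> B" "g \<in> G"
  shows "r \<otimes> g \<in> lspan B G"
proof -
  have "r \<otimes> g \<oplus> \<zero> \<in> lspan B G" using assms by (intro lspan.intros)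
  moreover have "r \<otimes> g \<in> carrier R" using assms by auto
  ultimately show ?thesis by simp
qed

lemma subset_lspan_one:
  assumes "subring B R" shows "B \<subseteq> lspan B {\<one>}"
proof
  fix y assume "y \<in> B"
  then show "y \<in> lspan B {\<one>}"
    using lspan_single[of B "{\<one>}" y \<one>] subringE(1)[OF assms] by auto
qed

text \<open>Expanding each coefficient from \<open>B\<close> in terms of \<open>H\<close> turns
  \<open>r \<otimes> g\<close> into terms \<open>s \<otimes> (h \<otimes> g)\<close>. Finite
  generation therefore survives when two eliminations are chained.\<close>

lemma lspan_trans:
  assumes "C \<subseteq> carrier R" "H \<subseteq> carrier R" "G \<subseteq> carrier R" "B \<subseteq> lspan C H"
    and "x \<in> lspan B G"
  shows "x \<in> lspan C ((\<lambda>(h, g). h \<otimes> g) ` (H \<times> G))" (is "_ \<in> lspan C ?K")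
  using assms(5)
proof (induction rule: lspan.induct)
  case lspan_zero
  then show ?case by (rule lspan.lspan_zero)
next
  case (lspan_step r g m)
  have K: "?K \<subseteq> carrier R" using assms by auto
  have "r \<in> lspan C H" using lspan_step assms(4) by blast
  then have "r \<otimes> g \<in> lspan C ?K"
  proof (induction rule: lspan.induct)
    case lspan_zero
    have "g \<in> carrier R" using \<open>g \<in> G\<close> assms(3) by blast
    then show ?case by (simp add: lspan.lspan_zero)
  next
    case (lspan_step s h m)
    have "(s \<otimes> h \<oplus> m) \<otimes> g = s \<otimes> (h \<otimes> g) \<oplus> m \<otimes> g"
      using lspan_step assms \<open>g \<in> G\<close> lspan_closed[OF assms(1,2)]
      by (subst l_distr) (auto simp: m_assoc subset_iff)
    then show ?case
      using lspan_step \<open>g \<in> G\<close> by (auto intro!: lspan.lspan_step)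
  qed
  then show ?case using lspan_add[OF assms(1) K] lspan_step by simp
qed

lemma lspan_finsum:
  assumes "subring B R" "finite G" "G \<subseteq> carrier R" "x \<in> lspan B G"
  shows "\<exists>r. (\<forall>g\<in>G. r g \<in> B) \<and> x = (\<Oplus>g\<in>G. r g \<otimes> g)"
  using assms(4)
proof (induction rule: lspan.induct)
  case lspan_zero
  have "(\<Oplus>g\<in>G. \<zero> \<otimes> g) = \<zero>"
    using assms(3) by (intro add.finprod_one_eqI) auto
  then show ?case using subringE(2)[OF assms(1)] by (intro exI[of _ "\<lambda>_. \<zero>"]) auto
next
  case (lspan_step s h m)
  then obtain r where r: "\<And>g. g \<in> G \<Longrightarrow> r g \<in> B" "m = (\<Oplus>g\<in>G. r g \<otimes> g)" by blast
  note B = subringE(1)[OF assms(1)]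
  have rc: "r g \<otimes> g \<in> carrier R" "r g \<in> carrier R" "g \<in> carrier R" if "g \<in> G" for g
    using r(1) B assms(3) that by auto
  have sc: "s \<in> carrier R" "s \<otimes> h \<in> carrier R" using lspan_step B assms(3) by auto
  \<comment> \<open>Padding the single term with zeros to a sum over all of \<open>G\<close> lets it
    merge coefficientwise with the sum for \<open>m\<close>, which collects repetitions of
    \<open>h\<close>.\<close>
  have "s \<otimes> h = (\<Oplus>g\<in>G. if g = h then s \<otimes> g else \<zero>)"
    using add.finprod_singleton_swap[of h G "\<lambda>g. s \<otimes> g"] lspan_step assms(2,3) sc
    by (auto simp: subset_iff)
  from arg_cong2[OF this r(2), of "(\<oplus>)"]
  have "s \<otimes> h \<oplus> m = (\<Oplus>g\<in>G. (if g = h then s \<otimes> g else \<zero>) \<oplus> r g \<otimes> g)"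
    by (subst finsum_addf) (use rc lspan_step B in \<open>auto simp: subset_iff\<close>)
  also have "\<dots> = (\<Oplus>g\<in>G. (if g = h then s \<oplus> r g else r g) \<otimes> g)"
    using rc sc by (intro finsum_cong') (auto simp: l_distr)
  finally show ?case
    using r(1) lspan_step(1) subringE(7)[OF assms(1)]
    by (intro exI[of _ "\<lambda>g. if g = h then s \<oplus> r g else r g"]) auto
qed

end

section \<open>Noether normalization in a ring over D\<close>

locale skew_extension = ring S for S :: "('b, 'c) ring_scheme" (structure) +
  fixes \<iota> :: "'a::division_ring \<Rightarrow> 'b" and \<sigma> :: "'a \<Rightarrow> 'a"
  assumes iota_closed [simp]: "\<iota> c \<in> carrier S"
    and iota_add: "\<iota> (c + d) = \<iota> c \<oplus> \<iota> d"
    and iota_mult: "\<iota> (c * d) = \<iota> c \<otimes> \<iota> d"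
    and iota_one [simp]: "\<iota> 1 = \<one>"
    and one_neq_zero: "\<one> \<noteq> \<zero>"
begin

lemma iota_zero [simp]: "\<iota> 0 = \<zero>"
  using iota_add[of 0 0] by (simp add: add.l_cancel_one')

text \<open>A nonzero \<open>c\<close> is invertible, so a zero image would force
  \<open>\<one> = \<zero>\<close>. For the quotient ring this is where properness of the ideal
  enters.\<close>

lemma iota_eq_zero: "\<iota> c = \<zero> \<Longrightarrow> c = 0"
  using iota_mult[of c "inverse c"] one_neq_zero by (cases "c = 0") auto

text \<open>All entries share one \<sigma>: the substitution mixes entries, and a combination of
  elements twisted by different automorphisms need not be automorphic.\<close>

definition automorphic_tuple :: "nat \<Rightarrow> (nat \<Rightarrow> 'b) \<Rightarrow> bool" where
  "automorphic_tuple n a \<longleftrightarrow> (\<forall>i<n. a i \<in> carrier S)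
     \<and> (\<forall>i<n. \<forall>j<n. a i \<otimes> a j = a j \<otimes> a i)
     \<and> (\<forall>i<n. \<forall>b. a i \<otimes> \<iota> b = \<iota> (\<sigma> b) \<otimes> a i)"

definition left_independent :: "nat \<Rightarrow> (nat \<Rightarrow> 'b) \<Rightarrow> bool" where
  "left_independent m a \<longleftrightarrow> (\<forall>(c :: (nat \<Rightarrow> nat) \<Rightarrow> 'a) E.
     finite E \<longrightarrow> (\<forall>e\<in>E. \<forall>k\<ge>m. e k = 0) \<longrightarrow>
     (\<Oplus> e\<in>E. \<iota> (c e) \<otimes> ring_monom S a e m) = \<zero> \<longrightarrow> (\<forall>e\<in>E. c e = 0))"

definition gen :: "nat \<Rightarrow> (nat \<Rightarrow> 'b) \<Rightarrow> 'b set" where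
  "gen n a = generate_ring S (range \<iota> \<union> a ` {..<n})"

lemma gen_subring: "automorphic_tuple n a \<Longrightarrow> subring (gen n a) S"
  unfolding gen_def by (rule generate_ring_is_subring) (auto simp: automorphic_tuple_def)

lemma iota_in_gen: "\<iota> c \<in> gen n a"
  unfolding gen_def by (rule generate_ring.incl) auto

lemma in_gen: "i < n \<Longrightarrow> a i \<in> gen n a"
  unfolding gen_def by (rule generate_ring.incl) auto

end

section \<open>Linear change of generators by central fixed scalars\<close>

locale linear_substitution = skew_extension S \<iota> \<sigma>
  for S :: "('b, 'c) ring_scheme" (structure) and \<iota> :: "'a::division_ring \<Rightarrow> 'b" and \<sigma> +
  fixes n :: nat and a :: "nat \<Rightarrow> 'b" and l :: "nat \<Rightarrow> 'a"
  assumes tuple: "automorphic_tuple (Suc n) a"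
    and l_central: "l i \<in> center_of \<inter> fixed_of \<sigma>"
    and l_last: "l n = 1"
begin

text \<open>Since \<open>l n = 1\<close>, the element \<open>b n\<close> is zero. The formula
  \<open>a i = b i \<oplus> \<iota> (l i) \<otimes> x\<close> thus covers \<open>x\<close> itself,
  while only \<open>n\<close> new generators remain.\<close>

definition b :: "nat \<Rightarrow> 'b" where
  "b i = a i \<ominus> \<iota> (l i) \<otimes> a n"

abbreviation x :: 'b where "x \<equiv> a n"

lemma a_closed [simp]: "i \<le> n \<Longrightarrow> a i \<in> carrier S"
  and a_commute: "i \<le> n \<Longrightarrow> j \<le> n \<Longrightarrow> a i \<otimes> a j = a j \<otimes> a i"
  and a_iota: "i \<le> n \<Longrightarrow> a i \<otimes> \<iota> c = \<iota> (\<sigma> c) \<otimes> a i"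
  using tuple by (auto simp: automorphic_tuple_def less_Suc_eq_le)

lemma l_fixed: "\<sigma> (l i) = l i" and l_commute: "l i * c = c * l i"
  using l_central[of i] by (auto simp: fixed_of_def center_of_def)

lemma b_closed [simp]: "i \<le> n \<Longrightarrow> b i \<in> carrier S"
  by (simp add: b_def)

lemma b_last: "b n = \<zero>"
  by (simp add: b_def l_last r_neg minus_eq)

lemma a_eq: "i \<le> n \<Longrightarrow> a i = b i \<oplus> \<iota> (l i) \<otimes> x"
  by (simp add: b_def minus_eq a_assoc l_neg)

text \<open>\<open>a i\<close> passes \<open>\<iota> (l j)\<close> unchanged because \<sigma> fixes
  \<open>l j\<close>, and it commutes with \<open>x\<close>.\<close>

lemma lx_commute:
  assumes "i \<le> n" shows "(\<iota> (l j) \<otimes> x) \<otimes> a i = a i \<otimes> (\<iota> (l j) \<otimes> x)"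
proof -
  have "(\<iota> (l j) \<otimes> x) \<otimes> a i = (\<iota> (l j) \<otimes> a i) \<otimes> x"
    using assms a_commute[of i n] by (simp add: m_assoc)
  also have "\<dots> = (a i \<otimes> \<iota> (l j)) \<otimes> x" using assms by (simp add: a_iota l_fixed)
  finally show ?thesis using assms by (simp add: m_assoc)
qed

lemma b_commute_a:
  assumes "i \<le> n" "j \<le> n" shows "b i \<otimes> a j = a j \<otimes> b i"
  using assms a_commute[of i j] lx_commute[of j i]
  by (simp add: b_def minus_eq l_distr r_distr l_minus r_minus)

text \<open>Moving \<open>c\<close> through the second summand of \<open>b i\<close> produces
  \<open>l i * \<sigma> c\<close>; centrality of \<open>l i\<close> brings \<open>\<sigma> c\<close>
  to the front, so both summands have the same twist.\<close>

lemma b_iota: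
  assumes "i \<le> n" shows "b i \<otimes> \<iota> c = \<iota> (\<sigma> c) \<otimes> b i"
proof -
  have "\<iota> (l i) \<otimes> x \<otimes> \<iota> c = \<iota> (l i * \<sigma> c) \<otimes> x"
    using a_iota[of n c] by (simp add: m_assoc iota_mult)
  also have "\<dots> = \<iota> (\<sigma> c) \<otimes> (\<iota> (l i) \<otimes> x)"
    by (simp add: l_commute iota_mult m_assoc)
  finally show ?thesis
    using assms a_iota[of i c] by (simp add: b_def minus_eq l_distr r_distr l_minus r_minus)
qed

lemma b_commute:
  assumes "i \<le> n" "j \<le> n" shows "b i \<otimes> b j = b j \<otimes> b i"
proof -
  have "b i \<otimes> \<iota> (l j) = \<iota> (l j) \<otimes> b i"
    using b_iota[OF assms(1), of "l j"] by (simp add: l_fixed)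
  then have "b i \<otimes> (\<iota> (l j) \<otimes> x) = \<iota> (l j) \<otimes> (b i \<otimes> x)"
    using assms by (simp flip: m_assoc)
  then have "b i \<otimes> (\<iota> (l j) \<otimes> x) = (\<iota> (l j) \<otimes> x) \<otimes> b i"
    using assms b_commute_a[of i n] by (simp add: m_assoc)
  then show ?thesis
    using assms b_commute_a[of i j]
    by (simp add: b_def[of j] minus_eq l_distr r_distr l_minus r_minus)
qed

lemma b_tuple: "automorphic_tuple n b"
  using b_commute b_iota by (simp add: automorphic_tuple_def)

section \<open>The subring \<open>B\<close>, polynomials in \<open>x\<close> over it and their
  leading coefficients\<close>

abbreviation B :: "'b set" where "B \<equiv> gen n b"

lemmas B_subring = gen_subring[OF b_tuple]
lemmas B_carrier = subringE(1)[OF B_subring]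

lemma b_in_B: "i \<le> n \<Longrightarrow> b i \<in> B"
  using in_gen[of i n b] subringE(2)[OF B_subring] b_last by (cases "i = n") auto

text \<open>The inclusion \<open>x B \<subseteq> B x\<close> replaces commutativity when
  coefficients are moved to the left of powers of \<open>x\<close>. It is inherited from the
  generators: constants are twisted by \<sigma>, and each \<open>b i\<close> commutes with
  \<open>x\<close>.\<close>

lemma x_B: "y \<in> B \<Longrightarrow> \<exists>y'\<in>B. x \<otimes> y = y' \<otimes> x"
  unfolding gen_def
proof (induction rule: generate_ring.induct)
  case one
  show ?case by (rule bexI[of _ \<one>]) (auto intro: generate_ring.one)
next
  case (incl h)
  then consider c where "h = \<iota> c" | i where "i < n" "h = b i" by auto
  then show ?case
  proof cases
    case 1
    then show ?thesis using a_iota[of n c] iota_in_gen[of "\<sigma> c" n b] by (auto simp: gen_def)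
  next
    case 2
    then have "x \<otimes> h = b i \<otimes> x" using b_commute_a[of i n] by simp
    then show ?thesis using in_gen[OF 2(1), of b] unfolding gen_def by blast
  qed
next
  case (a_inv h)
  then obtain y where y: "y \<in> B" "x \<otimes> h = y \<otimes> x" by (auto simp: gen_def)
  have "h \<in> carrier S" "y \<in> carrier S" using a_inv y B_carrier by (auto simp: gen_def)
  then have "x \<otimes> (\<ominus> h) = (\<ominus> y) \<otimes> x" using y by (simp add: r_minus l_minus)
  then show ?case using y by (auto simp: gen_def intro: generate_ring.a_inv)
next
  case (eng_add h1 h2)
  then obtain y1 y2 where y: "y1 \<in> B" "x \<otimes> h1 = y1 \<otimes> x" "y2 \<in> B" "x \<otimes> h2 = y2 \<otimes> x"
    by (auto simp: gen_def)
  have "h1 \<in> carrier S" "h2 \<in> carrier S" "y1 \<in> carrier S" "y2 \<in> carrier S"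
    using eng_add y B_carrier by (auto simp: gen_def)
  then have "x \<otimes> (h1 \<oplus> h2) = (y1 \<oplus> y2) \<otimes> x" using y by (simp add: r_distr l_distr)
  then show ?case using y by (auto simp: gen_def intro: generate_ring.eng_add)
next
  case (eng_mult h1 h2)
  then obtain y1 y2 where y: "y1 \<in> B" "x \<otimes> h1 = y1 \<otimes> x" "y2 \<in> B" "x \<otimes> h2 = y2 \<otimes> x"
    by (auto simp: gen_def)
  have c: "h1 \<in> carrier S" "h2 \<in> carrier S" "y1 \<in> carrier S" "y2 \<in> carrier S"
    using eng_mult y B_carrier by (auto simp: gen_def)
  then have "x \<otimes> (h1 \<otimes> h2) = (y1 \<otimes> x) \<otimes> h2" using y by (simp flip: m_assoc)
  also have "\<dots> = (y1 \<otimes> y2) \<otimes> x" using y c by (simp add: m_assoc)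
  finally show ?case using y by (auto simp: gen_def intro: generate_ring.eng_mult)
qed

lemma xpow_B: "y \<in> B \<Longrightarrow> \<exists>y'\<in>B. x [^] (j::nat) \<otimes> y = y' \<otimes> x [^] j"
proof (induction j arbitrary: y)
  case 0
  then have "x [^] (0::nat) \<otimes> y = y \<otimes> x [^] (0::nat)" using B_carrier by auto
  then show ?case using 0 by blast
next
  case (Suc j)
  from x_B[OF Suc.prems] obtain y1 where y1: "y1 \<in> B" "x \<otimes> y = y1 \<otimes> x" by blast
  from Suc.IH[OF y1(1)] obtain y2 where y2: "y2 \<in> B" "x [^] j \<otimes> y1 = y2 \<otimes> x [^] j" by blast
  have c: "y \<in> carrier S" "y1 \<in> carrier S" "y2 \<in> carrier S"
    using Suc.prems y1 y2 B_carrier by auto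
  have "x [^] Suc j \<otimes> y = x [^] j \<otimes> (y1 \<otimes> x)" using c y1 by (simp add: m_assoc)
  also have "\<dots> = y2 \<otimes> x [^] Suc j" using c y2 by (simp add: m_assoc[symmetric])
  finally show ?case using y2 by blast
qed

text \<open>Only powers strictly below \<open>d\<close> occur, so \<open>L 0\<close> is the zero
  module. The powers of \<open>x\<close> need not be independent over \<open>B\<close>, hence
  \<open>d\<close> is merely a formal degree bound.\<close>

definition L :: "nat \<Rightarrow> 'b set" where
  "L d = lspan B ((\<lambda>j. x [^] j) ` {..<d})"

lemma xpow_carrier: "(\<lambda>j. x [^] (j::nat)) ` J \<subseteq> carrier S"
  by auto

lemma L_closed [simp]: "m \<in> L d \<Longrightarrow> m \<in> carrier S"
  unfolding L_def using lspan_closed[OF B_carrier xpow_carrier] .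

lemma L_mono: "d \<le> d' \<Longrightarrow> m \<in> L d \<Longrightarrow> m \<in> L d'"
  unfolding L_def by (rule lspan_mono[rotated]) auto

lemma L_zero: "\<zero> \<in> L d"
  unfolding L_def by (rule lspan_zero)

lemma L_add: "m \<in> L d \<Longrightarrow> m' \<in> L d \<Longrightarrow> m \<oplus> m' \<in> L d"
  unfolding L_def by (rule lspan_add[OF B_carrier xpow_carrier])

lemma L_lmult: "y \<in> B \<Longrightarrow> m \<in> L d \<Longrightarrow> y \<otimes> m \<in> L d"
  unfolding L_def by (rule lspan_lmult[OF B_subring xpow_carrier])

lemma L_minus: "m \<in> L d \<Longrightarrow> \<ominus> m \<in> L d"
  unfolding L_def by (rule lspan_minus[OF B_subring xpow_carrier])

lemma L_single: "y \<in> B \<Longrightarrow> j < d \<Longrightarrow> y \<otimes> x [^] j \<in> L d"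
  unfolding L_def by (rule lspan_single[OF B_carrier xpow_carrier]) auto

lemma L_induct [consumes 1, case_names zero step]:
  assumes "m \<in> L d" "P \<zero>"
    and "\<And>r j m. r \<in> B \<Longrightarrow> j < d \<Longrightarrow> m \<in> L d \<Longrightarrow> P m \<Longrightarrow> P (r \<otimes> x [^] j \<oplus> m)"
  shows "P m"
  using assms(1) unfolding L_def
  by (induction rule: lspan.induct) (use assms(2,3) in \<open>auto simp: L_def\<close>)

lemma L_x: "m \<in> L d \<Longrightarrow> m \<otimes> x \<in> L (Suc d)"
proof (induction rule: L_induct)
  case zero
  then show ?case by (simp add: L_zero)
next
  case (step r j m)
  then have "(r \<otimes> x [^] j \<oplus> m) \<otimes> x = r \<otimes> x [^] Suc j \<oplus> m \<otimes> x"
    using B_carrier by (auto simp: l_distr m_assoc)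
  then show ?case using step L_add L_single[OF step(1), of "Suc j" "Suc d"] by simp
qed

text \<open>Moving \<open>y\<close> to the left past \<open>x [^] j\<close> keeps the exponent, so
  \<open>L d\<close> is a right \<open>B\<close>-module as well.\<close>

lemma L_B: "m \<in> L d \<Longrightarrow> y \<in> B \<Longrightarrow> m \<otimes> y \<in> L d"
proof (induction rule: L_induct)
  case zero
  then show ?case using B_carrier by (auto simp: L_zero)
next
  case (step r j m)
  obtain y' where y': "y' \<in> B" "x [^] j \<otimes> y = y' \<otimes> x [^] j" using xpow_B step by blast
  have c: "r \<in> carrier S" "y \<in> carrier S" "y' \<in> carrier S" using step y' B_carrier by auto
  have "(r \<otimes> x [^] j \<oplus> m) \<otimes> y = r \<otimes> (x [^] j \<otimes> y) \<oplus> m \<otimes> y"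
    using c step by (simp add: l_distr m_assoc)
  also have "\<dots> = (r \<otimes> y') \<otimes> x [^] j \<oplus> m \<otimes> y"
    using c y' by (simp add: m_assoc)
  finally show ?case
    using step y' subringE(6)[OF B_subring] by (simp add: L_add L_single)
qed

text \<open>\<open>y\<close> is a polynomial in \<open>x\<close> of formal degree \<open>d\<close> over \<open>B\<close>, whose coefficient \<open>\<mu>\<close> at
  \<open>x\<^sup>d\<close> lies in \<open>D\<close>.\<close>
definition lead :: "nat \<Rightarrow> 'a \<Rightarrow> 'b \<Rightarrow> bool" where
  "lead d \<mu> y \<longleftrightarrow> (\<exists>m\<in>L d. y = \<iota> \<mu> \<otimes> x [^] d \<oplus> m)"

lemma lead_closed: "lead d \<mu> y \<Longrightarrow> y \<in> carrier S"
  by (auto simp: lead_def)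

lemma lead_zero: "lead d 0 \<zero>"
  unfolding lead_def by (rule bexI[OF _ L_zero]) simp

lemma lead_one: "lead 0 1 \<one>"
  unfolding lead_def by (rule bexI[OF _ L_zero]) simp

lemma lead_add:
  assumes "lead d \<mu> y" "lead d \<nu> z" shows "lead d (\<mu> + \<nu>) (y \<oplus> z)"
proof -
  obtain m m' where m: "m \<in> L d" "y = \<iota> \<mu> \<otimes> x [^] d \<oplus> m" "m' \<in> L d" "z = \<iota> \<nu> \<otimes> x [^] d \<oplus> m'"
    using assms by (auto simp: lead_def)
  then have "y \<oplus> z = \<iota> (\<mu> + \<nu>) \<otimes> x [^] d \<oplus> (m \<oplus> m')"
    by (simp add: iota_add l_distr a_ac)
  then show ?thesis using m L_add by (auto simp: lead_def)
qed

lemma lead_lmult: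
  assumes "lead d \<mu> y" shows "lead d (c * \<mu>) (\<iota> c \<otimes> y)"
proof -
  obtain m where m: "m \<in> L d" "y = \<iota> \<mu> \<otimes> x [^] d \<oplus> m"
    using assms by (auto simp: lead_def)
  then have "\<iota> c \<otimes> y = \<iota> (c * \<mu>) \<otimes> x [^] d \<oplus> \<iota> c \<otimes> m"
    by (simp add: iota_mult r_distr m_assoc)
  then show ?thesis using m L_lmult[OF iota_in_gen] by (auto simp: lead_def)
qed

text \<open>Everything of formal degree \<open>d\<close> already lies in \<open>L d'\<close>. This
  absorbs the monomials of lower degree in \<open>lead_sum\<close>.\<close>

lemma lead_less:
  assumes "lead d \<mu> y" "d < d'" shows "lead d' 0 y"
proof -
  obtain m where m: "m \<in> L d" "y = \<iota> \<mu> \<otimes> x [^] d \<oplus> m"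
    using assms by (auto simp: lead_def)
  have "y \<in> L d'"
    unfolding m(2) using assms(2) L_mono[OF _ m(1), of d']
    by (intro L_add L_single iota_in_gen) auto
  then show ?thesis unfolding lead_def using m by (intro bexI[of _ y]) auto
qed

text \<open>Split \<open>a i\<close> into \<open>b i\<close> and \<open>l i\<close> times
  \<open>x\<close>. The first part does not raise the degree, as
  \<open>x [^] d \<otimes> b i\<close> is again a left multiple of \<open>x [^] d\<close>; the
  second raises it by one, and \<open>l i\<close> passes the powers of \<open>x\<close> because
  \<sigma> fixes it.\<close>

lemma lead_mult_a:
  assumes "lead d \<mu> y" "i \<le> n" shows "lead (Suc d) (\<mu> * l i) (y \<otimes> a i)"
proof -
  obtain m where m: "m \<in> L d" "y = \<iota> \<mu> \<otimes> x [^] d \<oplus> m"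
    using assms by (auto simp: lead_def)
  have pow: "x [^] j \<otimes> \<iota> (l i) = \<iota> (l i) \<otimes> x [^] j" for j :: nat
  proof (induction j)
    case (Suc j)
    have "x [^] Suc j \<otimes> \<iota> (l i) = x [^] j \<otimes> (\<iota> (l i) \<otimes> x)"
      using a_iota[of n "l i"] by (simp add: m_assoc l_fixed)
    also have "\<dots> = \<iota> (l i) \<otimes> x [^] Suc j" by (simp add: Suc flip: m_assoc)
    finally show ?case .
  qed simp
  obtain b' where b': "b' \<in> B" "x [^] d \<otimes> b i = b' \<otimes> x [^] d"
    using xpow_B b_in_B assms by blast
  have c: "b' \<in> carrier S" "b i \<in> carrier S" using b' B_carrier assms by auto
  define m' where "m' = (\<iota> \<mu> \<otimes> b') \<otimes> x [^] d \<oplus> (m \<otimes> b i \<oplus> m \<otimes> \<iota> (l i) \<otimes> x)"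
  have "y \<otimes> a i = (\<iota> \<mu> \<otimes> (x [^] d \<otimes> b i) \<oplus> \<iota> \<mu> \<otimes> (x [^] d \<otimes> \<iota> (l i)) \<otimes> x)
      \<oplus> (m \<otimes> b i \<oplus> m \<otimes> \<iota> (l i) \<otimes> x)"
    using c m assms(2) by (simp add: a_eq[of i] l_distr r_distr m_assoc a_ac)
  also have "\<dots> = \<iota> (\<mu> * l i) \<otimes> x [^] Suc d \<oplus> m'"
    unfolding b' pow m'_def using c m by (simp add: iota_mult m_assoc a_ac)
  finally have "y \<otimes> a i = \<iota> (\<mu> * l i) \<otimes> x [^] Suc d \<oplus> m'" .
  moreover have "m' \<in> L (Suc d)"
    unfolding m'_def
    using m b' subringE(6)[OF B_subring] iota_in_gen b_in_B[OF assms(2)]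
    by (intro L_add L_single L_x L_mono[of d "Suc d" "m \<otimes> b i"] L_B) auto
  ultimately show ?thesis unfolding lead_def by blast
qed

lemma lead_monom:
  "N \<le> Suc n \<Longrightarrow> lead (\<Sum>k<N. e k) (eval_monom l e N) (ring_monom S a e N)"
proof (induction N)
  case 0
  then show ?case by (simp add: lead_one)
next
  case (Suc N)
  have "lead (\<Sum>k<N. e k) (eval_monom l e N) (ring_monom S a e N)" using Suc by simp
  \<comment> \<open>Inner induction on the exponent of the new variable, multiplying by one factor
    \<open>a N\<close> at a time.\<close>
  then have "lead ((\<Sum>k<N. e k) + j) (eval_monom l e N * l N ^ j)
      (ring_monom S a e N \<otimes> a N [^] j)" for j
  proof (induction j)
    case 0
    then show ?case using lead_closed by simp
  next
    case (Suc j)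
    from lead_mult_a[OF Suc.IH[OF Suc.prems], of N] \<open>Suc N \<le> Suc n\<close>
    show ?case
      using lead_closed[OF Suc.prems]
      by (simp add: m_assoc mult.assoc power_commutes del: power_Suc add: power_Suc2)
  qed
  then show ?case by simp
qed

text \<open>Only monomials of total degree exactly \<open>d\<close> reach \<open>x [^] d\<close>, so
  its coefficient is the degree \<open>d\<close> form evaluated at \<open>l\<close>.\<close>

lemma lead_sum:
  assumes "finite E" "\<And>e. e \<in> E \<Longrightarrow> c e \<noteq> 0 \<Longrightarrow> (\<Sum>k\<le>n. e k) \<le> d"
  shows "lead d (\<Sum>e | e \<in> E \<and> (\<Sum>k\<le>n. e k) = d. c e * eval_monom l e (Suc n))
    (\<Oplus>e\<in>E. \<iota> (c e) \<otimes> ring_monom S a e (Suc n))"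
  using assms
proof (induction E rule: finite_induct)
  case empty
  then show ?case by (simp add: lead_zero)
next
  case (insert e E)
  define t where "t e = c e * eval_monom l e (Suc n)" for e
  have mon: "lead (\<Sum>k\<le>n. e k) (eval_monom l e (Suc n)) (ring_monom S a e (Suc n))" for e
    using lead_monom[of "Suc n" e] by (simp only: lessThan_Suc_atMost)
  note clo = lead_closed[OF mon]
  \<comment> \<open>The degree bound concerns nonzero coefficients only. A term with
    \<open>c e = 0\<close> may have larger degree, but it vanishes together with
    \<open>t e\<close>.\<close>
  have "lead d (if (\<Sum>k\<le>n. e k) = d then t e else 0) (\<iota> (c e) \<otimes> ring_monom S a e (Suc n))"
  proof (cases "c e = 0")
    case True
    then show ?thesis using lead_zero clo by (simp add: t_def del: ring_monom.simps)
  next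
    case False
    then have "(\<Sum>k\<le>n. e k) \<le> d" using insert.prems by auto
    then show ?thesis
      using lead_lmult[OF mon[of e], of "c e"] lead_less[OF lead_lmult[OF mon[of e], of "c e"], of d]
      by (auto simp: t_def simp del: ring_monom.simps eval_monom.simps)
  qed
  from lead_add[OF this insert.IH] insert.prems
  have "lead d ((if (\<Sum>k\<le>n. e k) = d then t e else 0)
        + (\<Sum>e | e \<in> E \<and> (\<Sum>k\<le>n. e k) = d. t e))
     (\<iota> (c e) \<otimes> ring_monom S a e (Suc n) \<oplus> (\<Oplus>e\<in>E. \<iota> (c e) \<otimes> ring_monom S a e (Suc n)))"
    by (simp add: t_def del: ring_monom.simps eval_monom.simps)
  moreover have "(if (\<Sum>k\<le>n. e k) = d then t e else 0) + (\<Sum>e | e \<in> E \<and> (\<Sum>k\<le>n. e k) = d. t e)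
      = (\<Sum>e' | e' \<in> insert e E \<and> (\<Sum>k\<le>n. e' k) = d. t e')"
  proof (cases "(\<Sum>k\<le>n. e k) = d")
    case True
    then have "{e' \<in> insert e E. (\<Sum>k\<le>n. e' k) = d} = insert e {e' \<in> E. (\<Sum>k\<le>n. e' k) = d}"
      by auto
    then show ?thesis using True insert.hyps by simp
  next
    case False
    then have "{e' \<in> insert e E. (\<Sum>k\<le>n. e' k) = d} = {e' \<in> E. (\<Sum>k\<le>n. e' k) = d}"
      by auto
    then show ?thesis using False by simp
  qed
  moreover have "(\<Oplus>e\<in>insert e E. \<iota> (c e) \<otimes> ring_monom S a e (Suc n))
      = \<iota> (c e) \<otimes> ring_monom S a e (Suc n) \<oplus> (\<Oplus>e\<in>E. \<iota> (c e) \<otimes> ring_monom S a e (Suc n))"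
    using insert.hyps clo by (intro finsum_insert) auto
  ultimately show ?case unfolding t_def by (simp only:)
qed

text \<open>A nonzero leading coefficient lies in a division ring and can be scaled to 1. The
  relation then expresses \<open>x [^] d\<close> through lower powers, so \<open>x\<close> is
  integral over \<open>B\<close>.\<close>

lemma lead_zero_imp:
  assumes "lead d \<gamma> \<zero>" "\<gamma> \<noteq> 0" shows "x [^] d \<in> L d"
proof -
  have "lead d 1 \<zero>" using lead_lmult[OF assms(1), of "inverse \<gamma>"] assms(2) by simp
  then obtain m where m: "m \<in> L d" "x [^] d \<oplus> m = \<zero>" by (auto simp: lead_def)
  then have "x [^] d = \<ominus> m" by (simp add: minus_equality)
  then show ?thesis using m L_minus by simp
qed

text \<open>Replacing \<open>x [^] d\<close> by lower powers makes \<open>L d\<close> stable under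
  right multiplication by \<open>x\<close>. Together with \<open>L_B\<close> this closes it under
  products, and each \<open>a i\<close> is the sum of an element of \<open>B\<close> and a multiple
  of \<open>x\<close>.\<close>

lemma gen_subset_L:
  assumes top: "x [^] d \<in> L d" shows "gen (Suc n) a \<subseteq> L d"
proof -
  have Lx: "m \<otimes> x \<in> L d" if "m \<in> L d" for m
  proof -
    have "m' \<in> L d" if "m' \<in> L (Suc d)" for m'
      using that
    proof (induction rule: L_induct)
      case zero
      then show ?case by (rule L_zero)
    next
      case (step r j m)
      then have "r \<otimes> x [^] j \<in> L d"
        using top L_lmult L_single by (cases "j = d") auto
      then show ?case using step by (simp add: L_add)
    qed
    then show ?thesis using L_x that by blast
  qed
  have Lxpow: "m \<otimes> x [^] j \<in> L d" if "m \<in> L d" for m and j :: nat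
    using that by (induction j) (auto simp: Lx simp flip: m_assoc)
  \<comment> \<open>For \<open>d = 0\<close> the assumption \<open>top\<close> is this very claim;
    otherwise \<open>\<one>\<close> is the power \<open>x [^] 0\<close>.\<close>
  have one: "\<one> \<in> L d"
    using top L_single[of \<one> 0 d] subringE(3)[OF B_subring] by (cases d) auto
  have B_L: "y \<in> L d" if "y \<in> B" for y
    using L_lmult[OF that one] that B_carrier by auto
  have mult: "m \<otimes> m' \<in> L d" if "m' \<in> L d" "m \<in> L d" for m m'
    using that
  proof (induction rule: L_induct)
    case zero
    then show ?case by (simp add: L_zero)
  next
    case (step r j m')
    have "r \<in> carrier S" using step B_carrier by auto
    then have "m \<otimes> (r \<otimes> x [^] j \<oplus> m') = (m \<otimes> r) \<otimes> x [^] j \<oplus> m \<otimes> m'"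
      using step by (simp add: r_distr m_assoc)
    then show ?case using step by (simp add: L_add Lxpow L_B)
  qed
  have "y \<in> L d" if "y \<in> gen (Suc n) a" for y
    using that unfolding gen_def
  proof (induction rule: generate_ring.induct)
    case (incl h)
    then consider c where "h = \<iota> c" | i where "i \<le> n" "h = a i" by (auto simp: less_Suc_eq_le)
    then show ?case
    proof cases
      case 1
      then show ?thesis using B_L iota_in_gen by simp
    next
      case 2
      then show ?thesis
        using a_eq[of i] L_add[OF B_L[OF b_in_B] Lx[OF B_L[OF iota_in_gen]]] by simp
    qed
  qed (auto simp: one L_minus L_add mult)
  then show ?thesis by blast
qed

end

section \<open>Elimination of one generator and induction on their number\<close>

context skew_extension
begin

lemma elimination_step:
  assumes aut: "is_automorphism \<sigma>" and inf: "infinite (center_of \<inter> fixed_of \<sigma>)"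
    and tuple: "automorphic_tuple (Suc n) a" and dep: "\<not> left_independent (Suc n) a"
  shows "\<exists>b G. automorphic_tuple n b \<and> finite G \<and> G \<subseteq> carrier S
    \<and> gen (Suc n) a \<subseteq> lspan (gen n b) G"
proof -
  obtain c :: "(nat \<Rightarrow> nat) \<Rightarrow> 'a" and E e0 where E: "finite E"
    "\<And>e k. e \<in> E \<Longrightarrow> Suc n \<le> k \<Longrightarrow> e k = 0"
    "(\<Oplus>e\<in>E. \<iota> (c e) \<otimes> ring_monom S a e (Suc n)) = \<zero>" and e0: "e0 \<in> E" "c e0 \<noteq> 0"
    using dep unfolding left_independent_def by blast
  define deg :: "(nat \<Rightarrow> nat) \<Rightarrow> nat" where "deg e = (\<Sum>k\<le>n. e k)" for e
  \<comment> \<open>The maximum runs over exponents with nonzero coefficient only, so the form of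
    degree \<open>d\<close> is not zero.\<close>
  define d where "d = Max (deg ` {e \<in> E. c e \<noteq> 0})"
  have "d \<in> deg ` {e \<in> E. c e \<noteq> 0}"
    unfolding d_def using E(1) e0 by (intro Max_in) auto
  then obtain e1 where e1: "e1 \<in> E" "c e1 \<noteq> 0" "deg e1 = d" by auto
  have d: "deg e \<le> d" if "e \<in> E" "c e \<noteq> 0" for e
    unfolding d_def using E(1) that by (intro Max_ge) auto
  define E' where "E' = {e \<in> E. deg e = d}"
  \<comment> \<open>Within degree \<open>d\<close> the first \<open>n\<close> exponents determine
    the one at \<open>n\<close>, and all later ones vanish.\<close>
  have inj: "e = e'" if "e \<in> E'" "e' \<in> E'" "\<And>k. k < n \<Longrightarrow> e k = e' k" for e e'
  proof
    fix k
    have "deg e = (\<Sum>k<n. e k) + e n" "deg e' = (\<Sum>k<n. e' k) + e' n"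
      by (simp_all add: deg_def flip: lessThan_Suc_atMost)
    moreover have "(\<Sum>k<n. e k) = (\<Sum>k<n. e' k)" using that(3) by (intro sum.cong) auto
    ultimately have "e n = e' n" using that(1,2) by (simp add: E'_def)
    then show "e k = e' k"
      using that E(2)[of e k] E(2)[of e' k] by (cases k n rule: linorder_cases) (auto simp: E'_def)
  qed
  have "finite E'" "e1 \<in> E'" using E(1) e1 by (auto simp: E'_def)
  then have "\<exists>l. (\<forall>k. l k \<in> center_of \<inter> fixed_of \<sigma>) \<and> (\<Sum>e\<in>E'. c e * eval_monom l e n) \<noteq> 0"
    using inf e1(2) inj by (intro central_nonvanishing_point) auto
  then obtain l where l: "\<And>k. l k \<in> center_of \<inter> fixed_of \<sigma>"
    and nz: "(\<Sum>e\<in>E'. c e * eval_monom l e n) \<noteq> 0" by blast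
  have one: "1 \<in> center_of \<inter> fixed_of \<sigma>"
    using aut by (simp add: is_automorphism_def center_of_def fixed_of_def)
  \<comment> \<open>Overwriting position \<open>n\<close> by 1 dehomogenizes the form: the factor
    with index \<open>n\<close> becomes 1 and the value from \<open>nz\<close> is unchanged.\<close>
  interpret linear_substitution S \<iota> \<sigma> n a "l(n := 1)"
    using tuple l one by unfold_locales auto
  have "eval_monom (l(n := 1)) e (Suc n) = eval_monom l e n" for e
    by (simp add: eval_monom_cong[of n "l(n := 1)" l])
  then have "lead d (\<Sum>e\<in>E'. c e * eval_monom l e n) \<zero>"
    using lead_sum[of E c d] E(1,3) d unfolding E'_def deg_def by simp
  then have "gen (Suc n) a \<subseteq> L d"
    using gen_subset_L lead_zero_imp nz by blast
  then show ?thesis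
    unfolding L_def using b_tuple xpow_carrier by blast
qed

text \<open>The zero exponent is the only one available, so a relation reads
  \<open>\<iota> (c e) = \<zero>\<close>, and \<open>\<iota>\<close> has trivial kernel.\<close>

lemma left_independent_0: "left_independent 0 a"
  unfolding left_independent_def
proof (intro allI impI ballI)
  fix c :: "(nat \<Rightarrow> nat) \<Rightarrow> 'a" and E e
  assume *: "\<forall>e\<in>E. \<forall>k\<ge>0. e k = (0::nat)" "e \<in> E"
    "(\<Oplus>e\<in>E. \<iota> (c e) \<otimes> ring_monom S a e 0) = \<zero>"
  then have "e' = (\<lambda>_. 0)" if "e' \<in> E" for e' using that by auto
  then have "E = {e}" using *(2) by blast
  then show "c e = 0" using *(3) iota_eq_zero by simp
qed

text \<open>The claim concerns the subring \<open>gen n a\<close> rather than all of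
  \<open>S\<close>, so that the induction hypothesis applies to the smaller subring
  \<open>gen n b\<close>; \<open>lspan_trans\<close> composes the two finite extensions.\<close>

lemma noether_normalization:
  assumes aut: "is_automorphism \<sigma>" and inf: "infinite (center_of \<inter> fixed_of \<sigma>)"
    and "automorphic_tuple n a"
  shows "\<exists>m a' G. automorphic_tuple m a' \<and> left_independent m a' \<and> finite G \<and> G \<subseteq> carrier S
    \<and> gen n a \<subseteq> lspan (gen m a') G"
  using assms(3)
proof (induction n arbitrary: a)
  case (0 a)
  then show ?case
    using left_independent_0 subset_lspan_one[OF gen_subring]
    by (intro exI[of _ 0] exI[of _ a] exI[of _ "{\<one>}"]) auto
next
  case (Suc n a)
  show ?case
  proof (cases "left_independent (Suc n) a")
    case True
    then show ?thesis
      using Suc.prems subset_lspan_one[OF gen_subring]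
      by (intro exI[of _ "Suc n"] exI[of _ a] exI[of _ "{\<one>}"]) auto
  next
    case False
    from elimination_step[OF aut inf Suc.prems False] obtain b G where
      b: "automorphic_tuple n b" "finite G" "G \<subseteq> carrier S"
      "gen (Suc n) a \<subseteq> lspan (gen n b) G" by blast
    from Suc.IH[OF b(1)] obtain m a' H where
      a': "automorphic_tuple m a'" "left_independent m a'" "finite H" "H \<subseteq> carrier S"
      "gen n b \<subseteq> lspan (gen m a') H" by blast
    have "gen (Suc n) a \<subseteq> lspan (gen m a') ((\<lambda>(h, g). h \<otimes> g) ` (H \<times> G))"
      using lspan_trans[OF subringE(1)[OF gen_subring[OF a'(1)]] a'(4) b(3) a'(5)] b(4) by blast
    moreover have "(\<lambda>(h, g). h \<otimes> g) ` (H \<times> G) \<subseteq> carrier S" using a'(4) b(3) by auto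
    moreover have "finite ((\<lambda>(h, g). h \<otimes> g) ` (H \<times> G))" using a'(3) b(2) by simp
    ultimately show ?thesis using a'(1,2) by meson
  qed
qed

text \<open>The normalizing tuple is again \<sigma>-automorphic, so every \<open>\<tau> i\<close> is
  \<sigma>. Enumerating \<open>G\<close> by \<open>g\<close> turns the sum over a set into the
  indexed sum required.\<close>

lemma automorphically_normalizable_if_generated:
  assumes aut: "is_automorphism \<sigma>" and inf: "infinite (center_of \<inter> fixed_of \<sigma>)"
    and "automorphic_tuple n a" and "carrier S \<subseteq> gen n a"
  shows "automorphically_normalizable S \<iota>"
proof -
  obtain m a' G where a': "automorphic_tuple m a'" and ind: "left_independent m a'"
    and G: "finite G" "G \<subseteq> carrier S" "gen n a \<subseteq> lspan (gen m a') G"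
    using noether_normalization[OF assms(1-3)] by blast
  obtain g where g: "bij_betw g {0..<card G} G"
    using ex_bij_betw_nat_finite[OF G(1)] by blast
  have span: "\<exists>r. (\<forall>l<card G. r l \<in> gen m a') \<and> s = (\<Oplus>l\<in>{..<card G}. r l \<otimes> g l)"
    if "s \<in> carrier S" for s
  proof -
    have "s \<in> lspan (gen m a') G" using that assms(4) G(3) by blast
    from lspan_finsum[OF gen_subring[OF a'] G(1,2) this] obtain r where
      r: "\<And>h. h \<in> G \<Longrightarrow> r h \<in> gen m a'" "s = (\<Oplus>h\<in>G. r h \<otimes> h)" by blast
    have img: "g ` {..<card G} = G" and inj: "inj_on g {..<card G}"
      using g by (auto simp: bij_betw_def lessThan_atLeast0)
    have "(\<lambda>h. r h \<otimes> h) \<in> g ` {..<card G} \<rightarrow> carrier S"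
      unfolding img using r(1) G(2) subringE(1)[OF gen_subring[OF a']] by blast
    from finsum_reindex[OF this inj] have "s = (\<Oplus>l\<in>{..<card G}. r (g l) \<otimes> g l)"
      unfolding r(2) img .
    then show ?thesis using r(1) img by (intro exI[of _ "\<lambda>l. r (g l)"]) auto
  qed
  have gc: "\<forall>l<card G. g l \<in> carrier S"
    using g G(2) by (auto simp: bij_betw_def subset_iff)
  show ?thesis
    unfolding automorphically_normalizable_def
  proof (rule exI[of _ m], rule exI[of _ a'], rule exI[of _ "\<lambda>_. \<sigma>"], intro conjI)
    show "\<exists>(k::nat) g. (\<forall>l<k. g l \<in> carrier S) \<and> (\<forall>s\<in>carrier S. \<exists>r.
        (\<forall>l<k. r l \<in> generate_ring S (range \<iota> \<union> a' ` {..<m})) \<and>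
        s = (\<Oplus>l\<in>{..<k}. r l \<otimes> g l))"
      by (rule exI[of _ "card G"], rule exI[of _ g], rule conjI[OF gc], rule ballI,
          rule span[unfolded gen_def])
    show "\<forall>i<m. a' i \<in> carrier S" "\<forall>i<m. \<forall>j<m. a' i \<otimes> a' j = a' j \<otimes> a' i"
      "\<forall>i<m. \<forall>b. a' i \<otimes> \<iota> b = \<iota> (\<sigma> b) \<otimes> a' i"
      using a' by (simp_all add: automorphic_tuple_def)
    show "\<forall>(c :: (nat \<Rightarrow> nat) \<Rightarrow> 'a) E. finite E \<longrightarrow> (\<forall>e\<in>E. \<forall>k\<ge>m. e k = 0) \<longrightarrow>
        (\<Oplus>e\<in>E. \<iota> (c e) \<otimes> ring_monom S a' e m) = \<zero> \<longrightarrow> (\<forall>e\<in>E. c e = 0)"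
      using ind unfolding left_independent_def .
  qed (use aut in simp_all)
qed

end

section \<open>Quotients of the skew polynomial ring\<close>

lemma automorphism_pow:
  assumes "is_automorphism \<sigma>"
  shows "(\<sigma> ^^ k) 0 = 0" "(\<sigma> ^^ k) 1 = 1"
proof -
  have "\<sigma> 0 + \<sigma> 0 = \<sigma> 0" using assms unfolding is_automorphism_def by (metis add_0)
  then show "(\<sigma> ^^ k) 0 = 0" by (induction k) auto
  show "(\<sigma> ^^ k) 1 = 1" using assms by (induction k) (auto simp: is_automorphism_def)
qed

lemma skew_pow_const: "skew_pow (\<lambda>_. \<sigma>) i n = \<sigma> ^^ (\<Sum>k<n. i k)"
  by (induction n) (auto simp: funpow_add)

definition skew_monom :: "'a::ring_1 \<Rightarrow> (nat \<Rightarrow> nat) \<Rightarrow> (nat \<Rightarrow> nat) \<Rightarrow> 'a" where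
  "skew_monom c i = (\<lambda>j. if j = i then c else 0)"

lemma skew_const_monom: "skew_const c = skew_monom c (\<lambda>_. 0)"
  by (simp add: skew_const_def skew_monom_def)

lemma skew_monom_carrier: "(\<And>k. n \<le> k \<Longrightarrow> i k = 0) \<Longrightarrow> skew_monom c i \<in> skew_carrier n"
  by (auto simp: skew_monom_def skew_carrier_def)

text \<open>The convolution has at most one pair of exponents. It has none if \<open>c\<close> or
  \<open>d\<close> is zero, in agreement with the right-hand side because powers of \<sigma> fix
  0.\<close>

lemma skew_mult_monom:
  assumes "is_automorphism \<sigma>"
  shows "skew_mult (\<lambda>_. \<sigma>) n (skew_monom c i) (skew_monom d j)
    = skew_monom (c * (\<sigma> ^^ (\<Sum>k<n. i k)) d) (\<lambda>k. i k + j k)"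
proof
  fix m
  let ?A = "{(i', j'). skew_monom c i i' \<noteq> 0 \<and> skew_monom d j j' \<noteq> 0 \<and> (\<lambda>k. i' k + j' k) = m}"
  have A: "?A = (if c \<noteq> 0 \<and> d \<noteq> 0 \<and> (\<lambda>k. i k + j k) = m then {(i, j)} else {})"
    by (auto simp: skew_monom_def split: if_splits)
  show "skew_mult (\<lambda>_. \<sigma>) n (skew_monom c i) (skew_monom d j) m
    = skew_monom (c * (\<sigma> ^^ (\<Sum>k<n. i k)) d) (\<lambda>k. i k + j k) m"
    unfolding skew_mult_def A
    using automorphism_pow(1)[OF assms] by (auto simp: skew_monom_def skew_pow_const)
qed

lemma (in ideal) quotient_one_neq_zero:
  assumes "I \<noteq> carrier R"
  shows "\<one>\<^bsub>R Quot I\<^esub> \<noteq> \<zero>\<^bsub>R Quot I\<^esub>"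
proof
  assume "\<one>\<^bsub>R Quot I\<^esub> = \<zero>\<^bsub>R Quot I\<^esub>"
  then have "I +> \<one> = I" by (simp add: FactRing_def)
  with a_rcos_self[OF one_closed] have "\<one> \<in> I" by blast
  then show False using one_imp_carrier assms by blast
qed

lemma (in ideal) carrier_quotient: "carrier (R Quot I) = (+>) I ` carrier R"
  by (auto simp: FactRing_def A_RCOSETS_def')

theorem theorem3p7:
  fixes \<sigma> :: "'a::division_ring \<Rightarrow> 'a" and n :: nat
  assumes "is_automorphism \<sigma>"
    and "infinite (center_of \<inter> fixed_of \<sigma>)"
  shows "tuple_automorphically_normalizable (\<lambda>_. \<sigma>) n"
  unfolding tuple_automorphically_normalizable_def
proof (intro allI impI)
  fix I
  let ?R = "skew_poly_ring (\<lambda>_. \<sigma>) n"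
  assume I: "ideal I ?R \<and> I \<noteq> carrier ?R"
  interpret R: ideal I ?R using I by blast
  let ?S = "?R Quot I"
  let ?f = "\<lambda>p. I +>\<^bsub>?R\<^esub> p"
  let ?\<iota> = "\<lambda>c. ?f (skew_const c)"
  interpret f: ring_hom_ring ?R ?S ?f by (rule R.rcos_ring_hom_ring)
  \<comment> \<open>\<open>u k\<close> is the exponent vector of the variable with index
    \<open>k\<close>, and \<open>a k\<close> is the image of that variable in the quotient.\<close>
  define u :: "nat \<Rightarrow> nat \<Rightarrow> nat" where "u k = (\<lambda>j. if j = k then 1 else 0)" for k
  define a where "a k = ?f (skew_monom 1 (u k))" for k
  have R: "carrier ?R = skew_carrier n" "\<one>\<^bsub>?R\<^esub> = skew_const 1"
    "p \<otimes>\<^bsub>?R\<^esub> q = skew_mult (\<lambda>_. \<sigma>) n p q" "p \<oplus>\<^bsub>?R\<^esub> q = (\<lambda>i. p i + q i)" for p q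
    by (simp_all add: skew_poly_ring_def)
  have uc: "skew_monom c (u k) \<in> carrier ?R" if "k < n" for c k
    unfolding R using that by (intro skew_monom_carrier) (auto simp: u_def)
  have su: "(\<Sum>j<n. u k j) = 1" if "k < n" for k
    using that by (simp add: u_def)
  have cc: "skew_const c \<in> carrier ?R" for c
    unfolding R skew_const_monom by (intro skew_monom_carrier) auto
  have cm: "skew_const c \<otimes>\<^bsub>?R\<^esub> skew_monom d i = skew_monom (c * d) i" for c d i
    unfolding R skew_const_monom skew_mult_monom[OF assms(1)] by simp
  have mm: "skew_monom 1 i \<otimes>\<^bsub>?R\<^esub> skew_monom 1 j = skew_monom 1 (\<lambda>k. i k + j k)" for i j
    unfolding R skew_mult_monom[OF assms(1)] automorphism_pow(2)[OF assms(1)] by simp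
  have uconst: "skew_monom 1 (u k) \<otimes>\<^bsub>?R\<^esub> skew_const c = skew_monom (\<sigma> c) (u k)" if "k < n" for k c
    unfolding R skew_const_monom skew_mult_monom[OF assms(1)] su[OF that] by simp
  interpret skew_extension ?S ?\<iota> \<sigma>
  proof
    show "?\<iota> c \<in> carrier ?S" for c using cc by simp
    show "?\<iota> (c + d) = ?\<iota> c \<oplus>\<^bsub>?S\<^esub> ?\<iota> d" for c d
    proof -
      have "skew_const (c + d) = skew_const c \<oplus>\<^bsub>?R\<^esub> skew_const d"
        unfolding R by (auto simp: skew_const_def)
      then show ?thesis using cc by simp
    qed
    show "?\<iota> (c * d) = ?\<iota> c \<otimes>\<^bsub>?S\<^esub> ?\<iota> d" for c d
      using cm[of c d "\<lambda>_. 0"] cc f.hom_mult[of "skew_const c" "skew_const d"]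
      by (simp add: skew_const_monom)
    show "?\<iota> 1 = \<one>\<^bsub>?S\<^esub>" using f.hom_one by (simp add: R)
    show "\<one>\<^bsub>?S\<^esub> \<noteq> \<zero>\<^bsub>?S\<^esub>"
      using R.quotient_one_neq_zero I by blast
  qed
  have tuple: "automorphic_tuple n a"
    unfolding automorphic_tuple_def
  proof (intro conjI allI impI)
    show "a i \<in> carrier ?S" if "i < n" for i using uc[OF that] by (simp add: a_def)
    show "a i \<otimes>\<^bsub>?S\<^esub> a j = a j \<otimes>\<^bsub>?S\<^esub> a i" if "i < n" "j < n" for i j
    proof -
      have "(\<lambda>k. u i k + u j k) = (\<lambda>k. u j k + u i k)" by auto
      then have "skew_monom 1 (u i) \<otimes>\<^bsub>?R\<^esub> skew_monom 1 (u j)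
          = skew_monom 1 (u j) \<otimes>\<^bsub>?R\<^esub> skew_monom 1 (u i)" unfolding mm by simp
      then show ?thesis
        unfolding a_def using uc that by (metis f.hom_mult)
    qed
    show "a i \<otimes>\<^bsub>?S\<^esub> ?\<iota> c = ?\<iota> (\<sigma> c) \<otimes>\<^bsub>?S\<^esub> a i" if "i < n" for i c
    proof -
      have "skew_monom 1 (u i) \<otimes>\<^bsub>?R\<^esub> skew_const c = skew_const (\<sigma> c) \<otimes>\<^bsub>?R\<^esub> skew_monom 1 (u i)"
        unfolding cm uconst[OF that] by simp
      then show ?thesis
        unfolding a_def using uc cc that by (metis f.hom_mult)
    qed
  qed
  note sub = gen_subring[OF tuple]
  \<comment> \<open>Induction on the total degree, splitting one variable off on the right.
    Monomials with coefficient 1 multiply by adding exponents, since \<sigma> fixes 1.\<close>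
  have monom1: "?f (skew_monom 1 i) \<in> gen n a" if "\<And>k. n \<le> k \<Longrightarrow> i k = 0" for i
    using that
  proof (induction "\<Sum>k<n. i k" arbitrary: i)
    case 0
    then have "i = (\<lambda>_. 0)" by (intro ext) (metis finite_lessThan lessThan_iff not_le sum_eq_0_iff)
    then show ?case using iota_in_gen[of 1 n a] by (simp add: skew_const_monom)
  next
    case (Suc s)
    have "(\<Sum>k<n. i k) \<noteq> 0" unfolding Suc.hyps(2)[symmetric] by simp
    then obtain k where k: "k < n" "i k \<noteq> 0"
      by (rule sum.not_neutral_contains_not_neutral) auto
    define i' where "i' = i(k := i k - 1)"
    have ii: "i = (\<lambda>j. i' j + u k j)" using k by (auto simp: i'_def u_def)
    then have "(\<Sum>j<n. i j) = (\<Sum>j<n. i' j + u k j)" by simp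
    then have "s = (\<Sum>j<n. i' j)" using su[OF k(1)] Suc.hyps(2) by (simp add: sum.distrib)
    moreover have i'0: "i' j = 0" if "n \<le> j" for j using Suc.prems[OF that] k by (auto simp: i'_def)
    ultimately have "?f (skew_monom 1 i') \<in> gen n a" using Suc.hyps(1) by blast
    moreover have "?f (skew_monom 1 i) = ?f (skew_monom 1 i') \<otimes>\<^bsub>?S\<^esub> a k"
      unfolding a_def using uc[OF k(1)] skew_monom_carrier[of n i' 1] i'0 mm[of i' "u k"]
      by (subst f.hom_mult[symmetric]) (auto simp: R(1) simp flip: ii)
    ultimately show ?case using in_gen[OF k(1)] subringE(6)[OF sub] by simp
  qed
  have monom: "?f (skew_monom c i) \<in> gen n a" if "\<And>k. n \<le> k \<Longrightarrow> i k = 0" for c i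
  proof -
    have "?f (skew_monom c i) = ?\<iota> c \<otimes>\<^bsub>?S\<^esub> ?f (skew_monom 1 i)"
      using cm[of c 1 i] cc skew_monom_carrier[of n i 1] that
      by (subst f.hom_mult[symmetric]) (auto simp: R(1))
    then show ?thesis using iota_in_gen monom1[OF that] subringE(6)[OF sub] by simp
  qed
  have poly: "?f p \<in> gen n a" if "p \<in> carrier ?R" for p
  proof -
    have "finite {i. p i \<noteq> 0}" using that by (simp add: R skew_carrier_def)
    then show ?thesis using that
    \<comment> \<open>Induction on the support: setting the coefficient at \<open>i\<close> to zero
      removes exactly one monomial, which \<open>monom\<close> covers.\<close>
    proof (induction "{i. p i \<noteq> 0}" arbitrary: p rule: finite_induct)
      case empty
      then have "p = skew_const 0" by (auto simp: skew_const_def)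
      then show ?case by (simp only: iota_in_gen)
    next
      case (insert i A)
      define q where "q = p(i := 0)"
      have supp: "{j. q j \<noteq> 0} = A" using insert.hyps(2,4) by (auto simp: q_def)
      have p: "finite {i. p i \<noteq> 0}" "\<And>j k. p j \<noteq> 0 \<Longrightarrow> n \<le> k \<Longrightarrow> j k = 0"
        using insert.prems by (auto simp: R skew_carrier_def)
      have q: "q \<in> carrier ?R"
        unfolding R skew_carrier_def using supp insert.hyps(1) p(2) by (auto simp: q_def)
      have pi: "\<And>k. n \<le> k \<Longrightarrow> i k = 0" using p(2)[of i] insert.hyps(4) by auto
      have "p = skew_monom (p i) i \<oplus>\<^bsub>?R\<^esub> q"
        unfolding R by (auto simp: q_def skew_monom_def)
      then have "?f p = ?f (skew_monom (p i) i) \<oplus>\<^bsub>?S\<^esub> ?f q"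
        using q skew_monom_carrier[of n i "p i"] pi by (metis R(1) f.hom_add)
      then show ?case
        using insert.hyps(3)[OF supp[symmetric] q] monom[OF pi] subringE(7)[OF sub] by simp
    qed
  qed
  have "carrier ?S \<subseteq> gen n a"
    unfolding R.carrier_quotient using poly by blast
  then show "automorphically_normalizable ?S ?\<iota>"
    by (rule automorphically_normalizable_if_generated[OF assms tuple])
qed

end
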